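(* Let $p$ be an odd prime. Let $\alpha,\beta\in\mathbb{Q}_p\setminus\mathbb{Q}$ be such that $F(\alpha,\beta)=0$, where $F(X,Y)\in\mathbb{Z}[X,Y]$ is a non-zero polynomial of minimal total degree $D$ among non-zero integer polynomials vanishing at $(\alpha,\beta)$. Let $(t_n)_{n\geq0},(u_n)_{n\geq0},(v_n)_{n\geq0}$ be sequences of integers with $v_n\neq0$ for every $n$ and \[\lim_{n\to\infty}\frac{t_n}{v_n}=\alpha,\qquad\lim_{n\to\infty}\frac{u_n}{v_n}=\beta\] in $\mathbb{Q}_p$. Let $M_n=\max\{|t_n|_\infty,|u_n|_\infty,|v_n|_\infty\}$ and $U_n=\max\left\{\left|\alpha-\frac{t_n}{v_n}\right|_p,\left|\beta-\frac{u_n}{v_n}\right|_p\right\}$. If $\lim_{n\to\infty}U_n\cdot M_n^D=0$ in $\mathbb{R}$, then $F\left(\frac{t_n}{v_n},\frac{u_n}{v_n}\right)=0$ for all sufficiently large $n$.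
   Context: $|\cdot|_\infty$ is the real absolute value and $|\cdot|_p$ the $p$-adic absolute value. *)

theory Defs
  imports "HOL-Analysis.Analysis" "Berlekamp_Zassenhaus.Finite_Field"
begin

hide_const (open) up_ring.coeff up_ring.monom

subsection \<open>The \<open>p\<close>-adic absolute value on the rationals\<close>

definition rat_padic_abs :: "nat \<Rightarrow> rat \<Rightarrow> real" where
  "rat_padic_abs p x = (if x = 0 then 0 else
     real p powi (int (multiplicity (int p) (snd (quotient_of x)))
                  - int (multiplicity (int p) (fst (quotient_of x)))))"

definition padic_Cauchy :: "nat \<Rightarrow> (nat \<Rightarrow> rat) \<Rightarrow> bool" where
  "padic_Cauchy p X \<longleftrightarrow> (\<forall>e>0. \<exists>k. \<forall>m\<ge>k. \<forall>n\<ge>k. rat_padic_abs p (X m - X n) < e)"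

definition padic_null :: "nat \<Rightarrow> (nat \<Rightarrow> rat) \<Rightarrow> bool" where
  "padic_null p X \<longleftrightarrow> (\<lambda>n. rat_padic_abs p (X n)) \<longlonglongrightarrow> 0"

definition padic_rel :: "nat \<Rightarrow> (nat \<Rightarrow> rat) \<Rightarrow> (nat \<Rightarrow> rat) \<Rightarrow> bool" where
  "padic_rel p X Y \<longleftrightarrow> padic_Cauchy p X \<and> padic_Cauchy p Y \<and> padic_null p (\<lambda>n. X n - Y n)"

lemma rat_padic_abs_0 [simp]: "rat_padic_abs p 0 = 0"
  by (simp add: rat_padic_abs_def)

context
  fixes p :: nat
  assumes p: "prime p"
begin

private abbreviation (input) N where "N \<equiv> rat_padic_abs p"

private lemma p_gt_0: "real p > 0" and p_gt_1: "real p > 1" and p_int: "prime_elem (int p)"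
  using p prime_gt_0_nat[OF p] prime_gt_1_nat[OF p] by auto

lemma rat_padic_abs_divide:
  assumes "a \<noteq> 0" "b \<noteq> 0"
  shows "rat_padic_abs p (of_int a / of_int b) =
    real p powi (int (multiplicity (int p) b) - int (multiplicity (int p) a))"
proof -
  obtain c d where q: "quotient_of (of_int a / of_int b) = (c, d)" by fastforce
  have d: "d > 0" using quotient_of_denom_pos[OF q] .
  have e: "(of_int a / of_int b :: rat) = of_int c / of_int d" using quotient_of_div[OF q] .
  then have c: "c \<noteq> 0" using assms d by auto
  have "(of_int (a * d) :: rat) = of_int (c * b)"
    using e assms d by (simp add: field_simps)
  then have "a * d = c * b" by (simp only: of_int_eq_iff)
  then have "multiplicity (int p) a + multiplicity (int p) d =
      multiplicity (int p) c + multiplicity (int p) b"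
    using prime_elem_multiplicity_mult_distrib[OF p_int] assms c d
    by (metis less_irrefl)
  then have "int (multiplicity (int p) b) - int (multiplicity (int p) a)
     = int (multiplicity (int p) d) - int (multiplicity (int p) c)" by linarith
  then show ?thesis using assms by (simp add: rat_padic_abs_def q)
qed

private lemma rat_common_denom:
  obtains a b c where "(x::rat) = of_int a / of_int b" "(y::rat) = of_int c / of_int b" "b \<noteq> 0"
proof -
  obtain a b where x: "quotient_of x = (a, b)" by fastforce
  obtain c d where y: "quotient_of y = (c, d)" by fastforce
  have bd: "b \<noteq> 0" "d \<noteq> 0"
    using quotient_of_denom_pos[OF x] quotient_of_denom_pos[OF y] by simp_all
  have "x = of_int (a * d) / of_int (b * d)" "y = of_int (c * b) / of_int (b * d)"
    using quotient_of_div[OF x] quotient_of_div[OF y] bd by simp_all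
  then show ?thesis using that bd by (metis mult_eq_0_iff)
qed

lemma rat_padic_abs_nonneg [simp]: "N x \<ge> 0"
  using p_gt_0 by (simp add: rat_padic_abs_def)

lemma rat_padic_abs_eq_0_iff [simp]: "N x = 0 \<longleftrightarrow> x = 0"
  using p_gt_0 by (simp add: rat_padic_abs_def)

lemma rat_padic_abs_mult: "N (x * y) = N x * N y"
proof (cases "x = 0 \<or> y = 0")
  case False
  obtain a b c where abc: "x = of_int a / of_int b" "(y::rat) = of_int c / of_int b" "b \<noteq> 0"
    by (rule rat_common_denom)
  have nz: "a \<noteq> 0" "c \<noteq> 0" using False abc by auto
  have "x * y = of_int (a * c) / of_int (b * b)" using abc by simp
  then have "N (x * y) = real p powi (int (multiplicity (int p) (b * b)) - int (multiplicity (int p) (a * c)))"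
    using rat_padic_abs_divide[of "a * c" "b * b"] nz abc by simp
  also have "\<dots> = real p powi ((int (multiplicity (int p) b) - int (multiplicity (int p) a)) +
      (int (multiplicity (int p) b) - int (multiplicity (int p) c)))"
    using nz abc by (simp add: prime_elem_multiplicity_mult_distrib[OF p_int] algebra_simps)
  also have "\<dots> = N x * N y"
    unfolding abc(1) abc(2) using nz abc p_gt_0
    by (subst power_int_add) (auto simp: rat_padic_abs_divide)
  finally show ?thesis .
qed auto

lemma rat_padic_abs_1 [simp]: "N 1 = 1"
  using rat_padic_abs_divide[of 1 1] by simp

lemma rat_padic_abs_inverse: "N (inverse x) = inverse (N x)"
proof (cases "x = 0")
  case False
  then have "N x * N (inverse x) = 1"
    by (simp flip: rat_padic_abs_mult)
  then show ?thesis using inverse_unique by fastforce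
qed auto

lemma rat_padic_abs_minus [simp]: "N (- x) = N x"
proof -
  have "N (-1) * N (-1) = 1" by (simp flip: rat_padic_abs_mult)
  then have "N (-1) = 1"
    using rat_padic_abs_nonneg[of "-1"] by (simp add: square_eq_1_iff)
  then show ?thesis using rat_padic_abs_mult[of "-1" x] by simp
qed

lemma rat_padic_abs_minus_commute: "N (x - y) = N (y - x)"
  using rat_padic_abs_minus[of "x - y"] by simp

lemma rat_padic_abs_ultrametric: "N (x + y) \<le> max (N x) (N y)"
proof (cases "x = 0 \<or> y = 0 \<or> x + y = 0")
  case True
  then show ?thesis by (auto simp: le_max_iff_disj)
next
  case False
  obtain a b c where abc: "x = of_int a / of_int b" "(y::rat) = of_int c / of_int b" "b \<noteq> 0"
    by (rule rat_common_denom)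
  have xy: "x + y = of_int (a + c) / of_int b" using abc by (simp add: add_divide_distrib)
  have nz: "a \<noteq> 0" "c \<noteq> 0" "a + c \<noteq> 0" using False abc xy by auto
  let ?m = "\<lambda>a. multiplicity (int p) a"
  have "int p ^ min (?m a) (?m c) dvd a + c"
    by (intro dvd_add multiplicity_dvd') auto
  then have "min (?m a) (?m c) \<le> ?m (a + c)"
    using nz p_int by (intro multiplicity_geI) (auto simp: prime_elem_def)
  then have "?m a \<le> ?m (a + c) \<or> ?m c \<le> ?m (a + c)" by linarith
  then have "real p powi (int (?m b) - int (?m (a+c))) \<le> real p powi (int (?m b) - int (?m a)) \<or>
    real p powi (int (?m b) - int (?m (a+c))) \<le> real p powi (int (?m b) - int (?m c))"
    using p_gt_1 by (auto intro!: power_int_increasing)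
  then show ?thesis
    unfolding xy unfolding abc(1,2)
    by (simp add: rat_padic_abs_divide nz abc le_max_iff_disj del: of_int_add)
qed

lemma rat_padic_abs_triangle: "N (x + y) \<le> N x + N y"
  using rat_padic_abs_ultrametric[of x y] rat_padic_abs_nonneg[of x] rat_padic_abs_nonneg[of y]
  by linarith

lemma rat_padic_abs_diff_abs: "\<bar>N x - N y\<bar> \<le> N (x - y)"
  using rat_padic_abs_triangle[of "x - y" y] rat_padic_abs_triangle[of "y - x" x]
    rat_padic_abs_minus_commute[of x y] by simp

lemma padic_CauchyD:
  assumes "padic_Cauchy p X" "e > 0"
  obtains k where "\<And>m n. m \<ge> k \<Longrightarrow> n \<ge> k \<Longrightarrow> N (X m - X n) < e"
  using assms unfolding padic_Cauchy_def by blast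

lemma padic_Cauchy_abs_convergent:
  assumes "padic_Cauchy p X"
  shows "convergent (\<lambda>n. N (X n))"
proof (rule real_Cauchy_convergent, rule metric_CauchyI)
  fix e :: real assume "e > 0"
  then obtain k where k: "\<And>m n. m \<ge> k \<Longrightarrow> n \<ge> k \<Longrightarrow> N (X m - X n) < e"
    using padic_CauchyD[OF assms] by metis
  have "\<forall>m\<ge>k. \<forall>n\<ge>k. dist (N (X m)) (N (X n)) < e"
    unfolding dist_real_def using k rat_padic_abs_diff_abs by (meson le_less_trans)
  then show "\<exists>M. \<forall>m\<ge>M. \<forall>n\<ge>M. dist (N (X m)) (N (X n)) < e" by blast
qed

lemma padic_Cauchy_bounded:
  assumes "padic_Cauchy p X"
  obtains B where "B > 0" "\<And>n. N (X n) \<le> B"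
proof -
  have "Bseq (\<lambda>n. N (X n))"
    using padic_Cauchy_abs_convergent[OF assms] by (rule convergent_imp_Bseq)
  then obtain B where "B > 0" "\<And>n. norm (N (X n)) \<le> B" by (auto elim: BseqE)
  then show ?thesis using that by auto
qed

lemma padic_null_le:
  assumes "padic_null p X" "\<And>n. N (Y n) \<le> B * N (X n)"
  shows "padic_null p Y"
proof -
  have "(\<lambda>n. B * N (X n)) \<longlonglongrightarrow> 0"
    using tendsto_mult_left[OF assms(1)[unfolded padic_null_def], of B] by simp
  then show ?thesis unfolding padic_null_def
    by (rule tendsto_sandwich[rotated 3, of _ _ _ "\<lambda>_. 0"]) (use assms(2) in auto)
qed

lemma padic_null_add:
  assumes "padic_null p X" "padic_null p Y"
  shows "padic_null p (\<lambda>n. X n + Y n)"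
proof -
  have "(\<lambda>n. N (X n) + N (Y n)) \<longlonglongrightarrow> 0"
    using tendsto_add[OF assms[unfolded padic_null_def]] by simp
  then show ?thesis unfolding padic_null_def
    by (rule tendsto_sandwich[rotated 3, of _ _ _ "\<lambda>_. 0"]) (auto simp: rat_padic_abs_triangle)
qed

lemma padic_null_uminus: "padic_null p (\<lambda>n. - X n) \<longleftrightarrow> padic_null p X"
  by (simp add: padic_null_def)

lemma padic_null_zero [simp]: "padic_null p (\<lambda>_. 0)"
  by (simp add: padic_null_def)

lemma padic_Cauchy_const [simp]: "padic_Cauchy p (\<lambda>_. c)"
  by (simp add: padic_Cauchy_def)

lemma padic_Cauchy_add:
  assumes "padic_Cauchy p X" "padic_Cauchy p Y"
  shows "padic_Cauchy p (\<lambda>n. X n + Y n)"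
  unfolding padic_Cauchy_def
proof (intro allI impI)
  fix e :: real assume e: "e > 0"
  obtain k where k: "\<And>m n. m \<ge> k \<Longrightarrow> n \<ge> k \<Longrightarrow> N (X m - X n) < e"
    using padic_CauchyD[OF assms(1) e] by metis
  obtain l where l: "\<And>m n. m \<ge> l \<Longrightarrow> n \<ge> l \<Longrightarrow> N (Y m - Y n) < e"
    using padic_CauchyD[OF assms(2) e] by metis
  have "N (X m + Y m - (X n + Y n)) < e" if "m \<ge> max k l" "n \<ge> max k l" for m n
    using rat_padic_abs_ultrametric[of "X m - X n" "Y m - Y n"] k[of m n] l[of m n] that
    by (simp add: algebra_simps)
  then show "\<exists>k. \<forall>m\<ge>k. \<forall>n\<ge>k. N (X m + Y m - (X n + Y n)) < e" by blast
qed

lemma padic_Cauchy_uminus: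
  assumes "padic_Cauchy p X"
  shows "padic_Cauchy p (\<lambda>n. - X n)"
proof -
  have "N (- X m - - X n) = N (X m - X n)" for m n
    using rat_padic_abs_minus[of "X m - X n"] by simp
  then show ?thesis using assms by (simp add: padic_Cauchy_def)
qed

lemma padic_Cauchy_mult:
  assumes X: "padic_Cauchy p X" and Y: "padic_Cauchy p Y"
  shows "padic_Cauchy p (\<lambda>n. X n * Y n)"
  unfolding padic_Cauchy_def
proof (intro allI impI)
  fix e :: real assume e: "e > 0"
  obtain B where B: "B > 0" "\<And>n. N (X n) \<le> B" using padic_Cauchy_bounded[OF X] by metis
  obtain C where C: "C > 0" "\<And>n. N (Y n) \<le> C" using padic_Cauchy_bounded[OF Y] by metis
  obtain k where k: "\<And>m n. m \<ge> k \<Longrightarrow> n \<ge> k \<Longrightarrow> N (X m - X n) < e / C"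
    using padic_CauchyD[OF X divide_pos_pos[OF e C(1)]] by metis
  obtain l where l: "\<And>m n. m \<ge> l \<Longrightarrow> n \<ge> l \<Longrightarrow> N (Y m - Y n) < e / B"
    using padic_CauchyD[OF Y divide_pos_pos[OF e B(1)]] by metis
  have "N (X m * Y m - X n * Y n) < e" if "m \<ge> max k l" "n \<ge> max k l" for m n
  proof -
    have "N ((X m - X n) * Y m) \<le> N (X m - X n) * C"
      using C by (simp add: rat_padic_abs_mult mult_left_mono)
    also have "\<dots> < e" using k[of m n] that C by (simp add: field_simps)
    finally have 1: "N ((X m - X n) * Y m) < e" .
    have "N (X n * (Y m - Y n)) \<le> B * N (Y m - Y n)"
      using B by (simp add: rat_padic_abs_mult mult_right_mono)
    also have "\<dots> < e" using l[of m n] that B by (simp add: field_simps)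
    finally have 2: "N (X n * (Y m - Y n)) < e" .
    have "X m * Y m - X n * Y n = (X m - X n) * Y m + X n * (Y m - Y n)"
      by (simp add: algebra_simps)
    then show ?thesis
      using rat_padic_abs_ultrametric[of "(X m - X n) * Y m" "X n * (Y m - Y n)"] 1 2 by simp
  qed
  then show "\<exists>k. \<forall>m\<ge>k. \<forall>n\<ge>k. N (X m * Y m - X n * Y n) < e" by blast
qed

lemma padic_not_null_lower_bound:
  assumes X: "padic_Cauchy p X" and "\<not> padic_null p X"
  obtains c k where "c > 0" "\<And>n. n \<ge> k \<Longrightarrow> N (X n) \<ge> c"
proof -
  from assms(2) obtain e where e: "e > 0" "\<And>k. \<exists>n\<ge>k. N (X n) \<ge> e"
    unfolding padic_null_def LIMSEQ_def by (auto simp: not_less)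
  obtain k where k: "\<And>m n. m \<ge> k \<Longrightarrow> n \<ge> k \<Longrightarrow> N (X m - X n) < e"
    using padic_CauchyD[OF X e(1)] by metis
  obtain n where n: "n \<ge> k" "N (X n) \<ge> e" using e(2) by blast
  have "N (X m) \<ge> e" if "m \<ge> k" for m
    using rat_padic_abs_ultrametric[of "X n - X m" "X m"] k[of n m] n that by auto
  then show ?thesis using that e by blast
qed

lemma padic_Cauchy_inverse:
  assumes X: "padic_Cauchy p X" and nn: "\<not> padic_null p X"
  shows "padic_Cauchy p (\<lambda>n. inverse (X n))"
  unfolding padic_Cauchy_def
proof (intro allI impI)
  fix e :: real assume e: "e > 0"
  obtain c l where c: "c > 0" "\<And>n. n \<ge> l \<Longrightarrow> N (X n) \<ge> c"
    using padic_not_null_lower_bound[OF assms] by metis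
  have "e * (c * c) > 0" using e c by simp
  then obtain k where k: "\<And>m n. m \<ge> k \<Longrightarrow> n \<ge> k \<Longrightarrow> N (X m - X n) < e * (c * c)"
    using padic_CauchyD[OF X] by metis
  have "N (inverse (X m) - inverse (X n)) < e" if "m \<ge> max k l" "n \<ge> max k l" for m n
  proof -
    have nz: "X m \<noteq> 0" "X n \<noteq> 0" using c(1) c(2)[of m] c(2)[of n] that by auto
    have "inverse (X m) - inverse (X n) = (X n - X m) * inverse (X m) * inverse (X n)"
      using nz by (simp add: field_simps)
    then have eq: "N (inverse (X m) - inverse (X n)) = N (X n - X m) / (N (X m) * N (X n))"
      by (simp only: rat_padic_abs_mult rat_padic_abs_inverse) (simp add: divide_inverse)
    have "N (X m) * N (X n) \<ge> c * c" using c that by (intro mult_mono) auto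
    then have "e * (c * c) \<le> e * (N (X m) * N (X n))" using e by (intro mult_left_mono) auto
    then have "N (X n - X m) < e * (N (X m) * N (X n))" using k[of n m] that by simp
    moreover have "0 < N (X m) * N (X n)"
      using nz by (intro mult_pos_pos) (simp_all add: order.strict_iff_order)
    ultimately show ?thesis unfolding eq by (simp only: pos_divide_less_eq)
  qed
  then show "\<exists>k. \<forall>m\<ge>k. \<forall>n\<ge>k. N (inverse (X m) - inverse (X n)) < e" by blast
qed

lemma padic_null_mult:
  assumes X: "padic_Cauchy p X" and Y: "padic_null p Y"
  shows "padic_null p (\<lambda>n. X n * Y n)"
proof -
  obtain B where B: "B > 0" "\<And>n. N (X n) \<le> B" using padic_Cauchy_bounded[OF X] by metis
  show ?thesis
    by (rule padic_null_le[OF Y, of _ B]) (use B in \<open>simp add: rat_padic_abs_mult mult_right_mono\<close>)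
qed

lemma padic_null_cong_ev:
  assumes "padic_null p X" "\<And>n. n \<ge> k \<Longrightarrow> X n = Y n"
  shows "padic_null p Y"
  using assms(1) unfolding padic_null_def
  by (rule Lim_transform_eventually)
     (use assms(2) in \<open>auto simp: eventually_sequentially intro!: exI[of _ k]\<close>)

lemma padic_rel_refl: "padic_Cauchy p X \<Longrightarrow> padic_rel p X X"
  by (simp add: padic_rel_def)

lemma padic_rel_sym: "padic_rel p X Y \<Longrightarrow> padic_rel p Y X"
  using rat_padic_abs_minus_commute by (simp add: padic_rel_def padic_null_def)

lemma padic_rel_trans: "padic_rel p X Y \<Longrightarrow> padic_rel p Y Z \<Longrightarrow> padic_rel p X Z"
  using padic_null_add[of "\<lambda>n. X n - Y n" "\<lambda>n. Y n - Z n"] by (simp add: padic_rel_def)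

lemma part_equivp_padic_rel: "part_equivp (padic_rel p)"
  by (rule part_equivpI)
     (auto intro!: sympI transpI intro: padic_rel_refl[OF padic_Cauchy_const] padic_rel_sym padic_rel_trans)

lemma padic_rel_null_iff: "padic_rel p X Y \<Longrightarrow> padic_null p X \<longleftrightarrow> padic_null p Y"
  using padic_null_add[of "\<lambda>n. X n - Y n" "Y"] padic_null_add[of "\<lambda>n. Y n - X n" "X"]
    padic_rel_sym[of X Y] by (auto simp: padic_rel_def)

lemma padic_rel_add:
  assumes "padic_rel p X X'" "padic_rel p Y Y'"
  shows "padic_rel p (\<lambda>n. X n + Y n) (\<lambda>n. X' n + Y' n)"
  using assms padic_null_add[of "\<lambda>n. X n - X' n" "\<lambda>n. Y n - Y' n"]
  by (simp add: padic_rel_def padic_Cauchy_add algebra_simps)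

lemma padic_rel_uminus:
  assumes "padic_rel p X X'"
  shows "padic_rel p (\<lambda>n. - X n) (\<lambda>n. - X' n)"
  using assms padic_null_uminus[of "\<lambda>n. X n - X' n"]
  by (simp add: padic_rel_def padic_Cauchy_uminus)

lemma padic_rel_mult:
  assumes "padic_rel p X X'" "padic_rel p Y Y'"
  shows "padic_rel p (\<lambda>n. X n * Y n) (\<lambda>n. X' n * Y' n)"
proof -
  have "padic_null p (\<lambda>n. X n * (Y n - Y' n) + Y' n * (X n - X' n))"
    using assms by (intro padic_null_add padic_null_mult) (auto simp: padic_rel_def)
  then have "padic_null p (\<lambda>n. X n * Y n - X' n * Y' n)"
    by (simp add: algebra_simps)
  then show ?thesis using assms by (simp add: padic_rel_def padic_Cauchy_mult)
qed

lemma padic_rel_inverse: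
  assumes XY: "padic_rel p X Y" and nn: "\<not> padic_null p X"
  shows "padic_rel p (\<lambda>n. inverse (X n)) (\<lambda>n. inverse (Y n))"
proof -
  have C: "padic_Cauchy p X" "padic_Cauchy p Y" and nn': "\<not> padic_null p Y"
    using assms padic_rel_null_iff by (auto simp: padic_rel_def)
  have I: "padic_Cauchy p (\<lambda>n. inverse (X n))" "padic_Cauchy p (\<lambda>n. inverse (Y n))"
    using C nn nn' by (auto intro: padic_Cauchy_inverse)
  obtain c k where k: "c > 0" "\<And>n. n \<ge> k \<Longrightarrow> N (X n) \<ge> c"
    using padic_not_null_lower_bound[OF C(1) nn] by metis
  obtain d l where l: "d > 0" "\<And>n. n \<ge> l \<Longrightarrow> N (Y n) \<ge> d"
    using padic_not_null_lower_bound[OF C(2) nn'] by metis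
  have "padic_null p (\<lambda>n. Y n - X n)"
    using padic_rel_sym[OF XY] by (simp add: padic_rel_def)
  then have "padic_null p (\<lambda>n. inverse (X n) * inverse (Y n) * (Y n - X n))"
    by (intro padic_null_mult padic_Cauchy_mult I)
  then have "padic_null p (\<lambda>n. inverse (X n) - inverse (Y n))"
  proof (rule padic_null_cong_ev[where k = "max k l"])
    fix n assume "n \<ge> max k l"
    then have "X n \<noteq> 0" "Y n \<noteq> 0" using k(1) k(2)[of n] l(1) l(2)[of n] by auto
    then show "inverse (X n) * inverse (Y n) * (Y n - X n) = inverse (X n) - inverse (Y n)"
      by (simp add: field_simps)
  qed
  then show ?thesis using I by (simp add: padic_rel_def)
qed

lemma padic_inverse_mult_null:
  assumes "padic_Cauchy p X" and "\<not> padic_null p X"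
  shows "padic_null p (\<lambda>n. inverse (X n) * X n - 1)"
proof -
  obtain c k where k: "c > 0" "\<And>n. n \<ge> k \<Longrightarrow> N (X n) \<ge> c"
    using padic_not_null_lower_bound[OF assms] by metis
  show ?thesis
  proof (rule padic_null_cong_ev[OF padic_null_zero, where k = k])
    fix n assume "n \<ge> k"
    then have "X n \<noteq> 0" using k(1) k(2)[of n] by auto
    then show "0 = inverse (X n) * X n - 1" by simp
  qed
qed

lemma padic_rel_lim_eq:
  assumes "padic_rel p X Y"
  shows "lim (\<lambda>n. N (X n)) = lim (\<lambda>n. N (Y n))"
proof -
  have "(\<lambda>n. N (X n)) \<longlonglongrightarrow> lim (\<lambda>n. N (X n))"
    using assms padic_Cauchy_abs_convergent by (simp add: padic_rel_def convergent_LIMSEQ_iff)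
  moreover have "(\<lambda>n. N (Y n) - N (X n)) \<longlonglongrightarrow> 0"
  proof (rule Lim_null_comparison)
    show "(\<lambda>n. N (Y n - X n)) \<longlonglongrightarrow> 0"
      using padic_rel_sym[OF assms] by (simp add: padic_rel_def padic_null_def)
    show "\<forall>\<^sub>F n in sequentially. norm (N (Y n) - N (X n)) \<le> N (Y n - X n)"
      using rat_padic_abs_diff_abs by simp
  qed
  ultimately have "(\<lambda>n. N (X n) + (N (Y n) - N (X n))) \<longlonglongrightarrow> lim (\<lambda>n. N (X n)) + 0"
    by (rule tendsto_add)
  then show ?thesis by (simp add: limI)
qed

lemma padic_Cauchy_abs_LIMSEQ:
  "padic_Cauchy p X \<Longrightarrow> (\<lambda>n. N (X n)) \<longlonglongrightarrow> lim (\<lambda>n. N (X n))"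
  using padic_Cauchy_abs_convergent by (simp add: convergent_LIMSEQ_iff)

end

subsection \<open>The field of \<open>p\<close>-adic numbers\<close>

text \<open>
  \<open>'p padic\<close> is the completion of the rationals with respect to the \<open>p\<close>-adic absolute value for
  the prime \<open>p = CARD('p)\<close>: Cauchy sequences of rationals modulo null sequences.
\<close>

typedef ('p::prime_card) padic =
  "{S. \<exists>X. padic_rel CARD('p) X X \<and> S = Collect (padic_rel CARD('p) X)}"
  morphisms padic_class Abs_padic
  using padic_rel_refl[OF prime_card padic_Cauchy_const[OF prime_card]] by blast

definition padic_lim :: "(nat \<Rightarrow> rat) \<Rightarrow> 'p::prime_card padic" where
  "padic_lim X = Abs_padic (Collect (padic_rel CARD('p) X))"

definition padic_rep :: "'p::prime_card padic \<Rightarrow> nat \<Rightarrow> rat" where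
  "padic_rep x = (SOME X. X \<in> padic_class x)"

definition cr_padic :: "(nat \<Rightarrow> rat) \<Rightarrow> 'p::prime_card padic \<Rightarrow> bool" where
  "cr_padic X x \<longleftrightarrow> padic_rel CARD('p) X X \<and> padic_lim X = x"

lemma Quotient_padic:
  "Quotient (padic_rel CARD('p)) padic_lim padic_rep (cr_padic :: _ \<Rightarrow> 'p::prime_card padic \<Rightarrow> bool)"
proof -
  interpret quot_type "padic_rel CARD('p)" Abs_padic "padic_class :: 'p padic \<Rightarrow> _"
  proof
    show "part_equivp (padic_rel CARD('p))" by (rule part_equivp_padic_rel[OF prime_card])
    show "\<exists>X. padic_rel CARD('p) X X \<and> padic_class x = Collect (padic_rel CARD('p) X)"
      for x :: "'p padic" using padic_class[of x] by blast
  qed (simp_all add: padic_class_inverse padic_class_inject Abs_padic_inverse)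
  have "abs = padic_lim" "rep = padic_rep"
    by (simp_all add: fun_eq_iff abs_def rep_def padic_lim_def padic_rep_def)
  then have "Quotient3 (padic_rel CARD('p)) padic_lim (padic_rep :: 'p padic \<Rightarrow> _)"
    using Quotient by metis
  then show ?thesis
    by (rule Quotient3_to_Quotient) (simp add: cr_padic_def fun_eq_iff atomize_eq)
qed

setup_lifting Quotient_padic

instantiation padic :: (prime_card) field
begin

lift_definition zero_padic :: "'a padic" is "\<lambda>_. 0"
  by (simp add: padic_rel_refl prime_card padic_Cauchy_const)

lift_definition one_padic :: "'a padic" is "\<lambda>_. 1"
  by (simp add: padic_rel_refl prime_card padic_Cauchy_const)

lift_definition plus_padic :: "'a padic \<Rightarrow> 'a padic \<Rightarrow> 'a padic" is "\<lambda>X Y n. X n + Y n"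
  by (rule padic_rel_add[OF prime_card])

lift_definition uminus_padic :: "'a padic \<Rightarrow> 'a padic" is "\<lambda>X n. - X n"
  by (rule padic_rel_uminus[OF prime_card])

lift_definition times_padic :: "'a padic \<Rightarrow> 'a padic \<Rightarrow> 'a padic" is "\<lambda>X Y n. X n * Y n"
  by (rule padic_rel_mult[OF prime_card])

lift_definition inverse_padic :: "'a padic \<Rightarrow> 'a padic"
  is "\<lambda>X. if padic_null CARD('a) X then (\<lambda>_. 0) else (\<lambda>n. inverse (X n))"
  using padic_rel_inverse[OF prime_card] padic_rel_null_iff[OF prime_card]
    padic_rel_refl[OF prime_card padic_Cauchy_const[OF prime_card]] by auto

definition minus_padic :: "'a padic \<Rightarrow> 'a padic \<Rightarrow> 'a padic"
  where "minus_padic x y = x + (- y)"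

definition divide_padic :: "'a padic \<Rightarrow> 'a padic \<Rightarrow> 'a padic"
  where "divide_padic x y = x * inverse y"

instance
proof
  note rel = padic_rel_def padic_null_zero[OF prime_card] padic_Cauchy_add[OF prime_card]
    padic_Cauchy_mult[OF prime_card] padic_Cauchy_uminus[OF prime_card]
    padic_Cauchy_const[OF prime_card]
  fix a b c :: "'a padic"
  show "a + b + c = a + (b + c)" by transfer (simp add: rel algebra_simps)
  show "a + b = b + a" by transfer (simp add: rel algebra_simps)
  show "0 + a = a" by transfer (simp add: rel)
  show "- a + a = 0" by transfer (simp add: rel)
  show "a - b = a + - b" by (rule minus_padic_def)
  show "a * b * c = a * (b * c)" by transfer (simp add: rel algebra_simps)
  show "a * b = b * a" by transfer (simp add: rel algebra_simps)
  show "1 * a = a" by transfer (simp add: rel)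
  show "(a + b) * c = a * c + b * c" by transfer (simp add: rel algebra_simps)
  show "(0::'a padic) \<noteq> 1"
    by transfer (simp add: rel padic_null_def rat_padic_abs_minus[OF prime_card]
        rat_padic_abs_1[OF prime_card] LIMSEQ_const_iff)
  show "a \<noteq> 0 \<Longrightarrow> inverse a * a = 1"
    by transfer (auto simp: rel padic_Cauchy_inverse[OF prime_card]
        padic_inverse_mult_null[OF prime_card])
  show "a div b = a * inverse b" by (rule divide_padic_def)
  show "inverse (0::'a padic) = 0"
    by transfer (simp add: rel)
qed

end

lift_definition padic_abs :: "'p::prime_card padic \<Rightarrow> real"
  is "\<lambda>X. lim (\<lambda>n. rat_padic_abs CARD('p) (X n))"
  by (rule padic_rel_lim_eq[OF prime_card])

lemma padic_abs_nonneg [simp]: "padic_abs x \<ge> 0"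
proof (transfer)
  fix X assume "padic_rel CARD('a) X X"
  then have "(\<lambda>n. rat_padic_abs CARD('a) (X n)) \<longlonglongrightarrow> lim (\<lambda>n. rat_padic_abs CARD('a) (X n))"
    by (intro padic_Cauchy_abs_LIMSEQ[OF prime_card]) (simp add: padic_rel_def)
  then show "0 \<le> lim (\<lambda>n. rat_padic_abs CARD('a) (X n))"
    by (rule LIMSEQ_le_const) (simp add: rat_padic_abs_nonneg[OF prime_card])
qed

lemma padic_abs_0 [simp]: "padic_abs 0 = 0"
  by transfer simp

lemma padic_abs_eq_0_iff [simp]: "padic_abs x = 0 \<longleftrightarrow> x = 0"
proof
  show "padic_abs x = 0 \<Longrightarrow> x = 0"
  proof (transfer)
    fix X assume X: "padic_rel CARD('a) X X" and "lim (\<lambda>n. rat_padic_abs CARD('a) (X n)) = 0"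
    then have "padic_null CARD('a) X"
      using padic_Cauchy_abs_LIMSEQ[OF prime_card[where 'a = 'a], of X] by (simp add: padic_rel_def padic_null_def)
    then show "padic_rel CARD('a) X (\<lambda>_. 0)"
      using X by (simp add: padic_rel_def padic_Cauchy_const[OF prime_card])
  qed
qed simp

lemma padic_abs_mult: "padic_abs (x * y) = padic_abs x * padic_abs y"
proof (transfer)
  fix X Y assume "padic_rel CARD('a) X X" "padic_rel CARD('a) Y Y"
  then have "(\<lambda>n. rat_padic_abs CARD('a) (X n) * rat_padic_abs CARD('a) (Y n)) \<longlonglongrightarrow>
      lim (\<lambda>n. rat_padic_abs CARD('a) (X n)) * lim (\<lambda>n. rat_padic_abs CARD('a) (Y n))"
    by (intro tendsto_mult padic_Cauchy_abs_LIMSEQ[OF prime_card]) (simp_all add: padic_rel_def)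
  then show "lim (\<lambda>n. rat_padic_abs CARD('a) (X n * Y n)) =
      lim (\<lambda>n. rat_padic_abs CARD('a) (X n)) * lim (\<lambda>n. rat_padic_abs CARD('a) (Y n))"
    by (simp add: rat_padic_abs_mult[OF prime_card] limI)
qed

lemma padic_abs_ultrametric: "padic_abs (x + y) \<le> max (padic_abs x) (padic_abs y)"
proof (transfer)
  fix X Y assume "padic_rel CARD('a) X X" "padic_rel CARD('a) Y Y"
  then have C: "padic_Cauchy CARD('a) X" "padic_Cauchy CARD('a) Y" by (simp_all add: padic_rel_def)
  show "lim (\<lambda>n. rat_padic_abs CARD('a) (X n + Y n)) \<le>
      max (lim (\<lambda>n. rat_padic_abs CARD('a) (X n))) (lim (\<lambda>n. rat_padic_abs CARD('a) (Y n)))"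
  proof (rule LIMSEQ_le)
    show "(\<lambda>n. rat_padic_abs CARD('a) (X n + Y n)) \<longlonglongrightarrow> lim (\<lambda>n. rat_padic_abs CARD('a) (X n + Y n))"
      using C by (intro padic_Cauchy_abs_LIMSEQ padic_Cauchy_add prime_card)
    show "(\<lambda>n. max (rat_padic_abs CARD('a) (X n)) (rat_padic_abs CARD('a) (Y n))) \<longlonglongrightarrow>
      max (lim (\<lambda>n. rat_padic_abs CARD('a) (X n))) (lim (\<lambda>n. rat_padic_abs CARD('a) (Y n)))"
      using C by (intro tendsto_max padic_Cauchy_abs_LIMSEQ prime_card)
  qed (use rat_padic_abs_ultrametric[OF prime_card] in blast)
qed

lemma padic_abs_minus [simp]: "padic_abs (- x) = padic_abs x"
  by transfer (simp add: rat_padic_abs_minus[OF prime_card])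

lemma padic_abs_minus_commute: "padic_abs (x - y) = padic_abs (y - x)"
  using padic_abs_minus[of "x - y"] by simp

lemma padic_abs_triangle: "padic_abs (x + y) \<le> padic_abs x + padic_abs y"
  using padic_abs_ultrametric[of x y] padic_abs_nonneg[of x] padic_abs_nonneg[of y] by linarith

lift_definition padic_const :: "rat \<Rightarrow> 'p::prime_card padic" is "\<lambda>r _. r"
  by (simp add: padic_rel_refl prime_card padic_Cauchy_const)

lemma padic_const_mult: "padic_const (r * s) = padic_const r * padic_const s"
  by transfer (simp add: padic_rel_refl prime_card padic_Cauchy_const)

lemma padic_const_minus: "padic_const (- r) = - padic_const r"
  by transfer (simp add: padic_rel_refl prime_card padic_Cauchy_const)

lemma padic_abs_const: "padic_abs (padic_const r :: 'p::prime_card padic) = rat_padic_abs CARD('p) r"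
  by transfer simp

lemma padic_const_of_nat: "padic_const (of_nat k) = of_nat k"
proof (induction k)
  case 0
  show ?case by (simp, transfer) (simp add: padic_rel_refl prime_card padic_Cauchy_const)
next
  case (Suc k)
  have "padic_const (1 + of_nat k) = 1 + (padic_const (of_nat k) :: 'a padic)"
    by transfer (simp add: padic_rel_refl prime_card padic_Cauchy_const)
  then show ?case by (simp add: Suc)
qed

lemma padic_abs_of_nat:
  "padic_abs (of_nat k :: 'p::prime_card padic) = rat_padic_abs CARD('p) (of_nat k)"
  by (metis padic_abs_const padic_const_of_nat)

instance padic :: (prime_card) field_char_0
proof
  show "inj (of_nat :: nat \<Rightarrow> 'a padic)"
  proof (rule injI)
    fix m n :: nat
    have *: "m = n" if "of_nat m = (of_nat n :: 'a padic)" "m \<le> n" for m n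
    proof -
      have "of_nat (n - m) = (0 :: 'a padic)" using that by (simp add: of_nat_diff)
      then have "rat_padic_abs CARD('a) (of_nat (n - m)) = 0"
        by (metis padic_abs_of_nat padic_abs_0)
      then show ?thesis
        using that rat_padic_abs_eq_0_iff[OF prime_card[where 'a = 'a]]
        by (metis diff_is_0_eq le_antisym of_nat_eq_0_iff)
    qed
    assume "of_nat m = (of_nat n :: 'a padic)"
    then show "m = n" using *[of m n] *[of n m] by (cases m n rule: le_cases) auto
  qed
qed

lemma padic_const_eq_of_rat: "padic_const r = of_rat r"
proof -
  have int: "padic_const (of_int i) = (of_int i :: 'a padic)" for i
    by (cases i rule: int_cases2) (simp_all add: padic_const_of_nat padic_const_minus)
  obtain a b where "quotient_of r = (a, b)" by fastforce
  then have r: "r = of_int a / of_int b" "b > 0"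
    using quotient_of_div quotient_of_denom_pos by blast+
  have "padic_const r * padic_const (of_int b) = (padic_const (of_int a) :: 'a padic)"
    using r by (simp flip: padic_const_mult)
  then have "padic_const r = (of_int a / of_int b :: 'a padic)"
    using r(2) unfolding int by (simp add: eq_divide_eq)
  also have "\<dots> = of_rat r"
    by (simp add: r(1) of_rat_divide)
  finally show ?thesis .
qed

lemma padic_abs_of_rat:
  "padic_abs (of_rat r :: 'p::prime_card padic) = rat_padic_abs CARD('p) r"
  by (simp flip: padic_const_eq_of_rat add: padic_abs_const)

instantiation padic :: (prime_card) metric_space
begin

definition dist_padic :: "'a padic \<Rightarrow> 'a padic \<Rightarrow> real"
  where "dist_padic x y = padic_abs (x - y)"

definition uniformity_padic :: "('a padic \<times> 'a padic) filter"
  where "uniformity_padic = (INF e\<in>{0 <..}. principal {(x, y). dist x y < e})"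

definition open_padic :: "'a padic set \<Rightarrow> bool"
  where "open_padic U \<longleftrightarrow> (\<forall>x\<in>U. \<forall>\<^sub>F (x', y) in uniformity. x' = x \<longrightarrow> y \<in> U)"

instance
proof
  fix x y z :: "'a padic"
  show "dist x y = 0 \<longleftrightarrow> x = y" by (simp add: dist_padic_def)
  show "dist x y \<le> dist x z + dist y z"
    using padic_abs_triangle[of "x - z" "z - y"]
    by (simp add: dist_padic_def padic_abs_minus_commute[of z y])
qed (simp_all add: uniformity_padic_def open_padic_def)

end

lemma padic_lim_LIMSEQ:
  assumes X: "padic_Cauchy CARD('p) X"
  shows "(\<lambda>n. of_rat (X n)) \<longlonglongrightarrow> (padic_lim X :: 'p::prime_card padic)"
proof (rule metric_LIMSEQ_I)
  fix e :: real assume "e > 0"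
  then obtain k where k: "\<And>m n. m \<ge> k \<Longrightarrow> n \<ge> k \<Longrightarrow> rat_padic_abs CARD('p) (X m - X n) < e / 2"
    using padic_CauchyD[OF prime_card X, of "e / 2"] by (metis half_gt_zero)
  have pcr: "pcr_padic X (padic_lim X :: 'p padic)"
    using X by (simp add: padic.pcr_cr_eq cr_padic_def padic_rel_refl[OF prime_card])
  have "dist (of_rat (X m)) (padic_lim X :: 'p padic) < e" if "m \<ge> k" for m
  proof -
    have C: "padic_Cauchy CARD('p) (\<lambda>n. X n + - X m)"
      using X by (intro padic_Cauchy_add padic_Cauchy_const prime_card)
    have "pcr_padic (\<lambda>n. X n + - X m) (padic_lim X + padic_const (- X m) :: 'p padic)"
      using plus_padic.transfer[unfolded rel_fun_def, rule_format, OF pcr,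
          OF padic_const.transfer[unfolded rel_fun_def, rule_format, OF refl]] .
    then have "padic_abs (padic_lim X + padic_const (- X m) :: 'p padic) =
        lim (\<lambda>n. rat_padic_abs CARD('p) (X n + - X m))"
      using padic_abs.transfer[unfolded rel_fun_def, rule_format] by metis
    moreover have "lim (\<lambda>n. rat_padic_abs CARD('p) (X n + - X m)) \<le> e / 2"
      using padic_Cauchy_abs_LIMSEQ[OF prime_card C]
      by (rule LIMSEQ_le_const2) (use k that in \<open>auto intro!: exI[of _ k] less_imp_le\<close>)
    moreover have "dist (of_rat (X m)) (padic_lim X :: 'p padic) =
        padic_abs (padic_lim X + padic_const (- X m) :: 'p padic)"
      by (simp add: dist_padic_def of_rat_minus padic_const_eq_of_rat
          padic_abs_minus_commute[of "of_rat (X m)"])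
    ultimately show ?thesis using \<open>e > 0\<close> by linarith
  qed
  then show "\<exists>k. \<forall>m\<ge>k. dist (of_rat (X m)) (padic_lim X :: 'p padic) < e" by blast
qed

lemma padic_rat_approx:
  assumes "e > 0"
  obtains r where "dist (x :: 'p::prime_card padic) (of_rat r) < e"
proof -
  have "padic_rel CARD('p) (padic_rep x) (padic_rep x)" "padic_lim (padic_rep x) = x"
    using Quotient_rep_reflp[OF Quotient_padic] Quotient_abs_rep[OF Quotient_padic] by metis+
  then have "(\<lambda>n. of_rat (padic_rep x n)) \<longlonglongrightarrow> x"
    using padic_lim_LIMSEQ[where 'p = 'p and X = "padic_rep x"] by (simp add: padic_rel_def)
  then obtain n where "dist (of_rat (padic_rep x n)) x < e"
    using metric_LIMSEQ_D[OF _ assms] by blast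
  then show ?thesis using that by (metis dist_commute)
qed

instance padic :: (prime_card) complete_space
proof
  fix x :: "nat \<Rightarrow> 'a padic" assume x: "Cauchy x"
  have "\<forall>n. \<exists>r. dist (x n) (of_rat r) < inverse (real (Suc n))"
    using padic_rat_approx by (metis inverse_positive_iff_positive of_nat_0_less_iff zero_less_Suc)
  then obtain r where r: "\<And>n. dist (x n) (of_rat (r n)) < inverse (real (Suc n))" by metis
  have null: "(\<lambda>n. dist (x n) (of_rat (r n))) \<longlonglongrightarrow> 0"
    by (rule tendsto_sandwich[OF _ _ tendsto_const LIMSEQ_inverse_real_of_nat])
       (simp_all add: less_imp_le[OF r] del: of_nat_Suc)
  have "padic_Cauchy CARD('a) r"
    unfolding padic_Cauchy_def
  proof (intro allI impI)
    fix e :: real assume e: "e > 0"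
    obtain k where k: "\<And>m n. m \<ge> k \<Longrightarrow> n \<ge> k \<Longrightarrow> dist (x m) (x n) < e / 3"
      using metric_CauchyD[OF x, of "e / 3"] e by auto
    obtain l where l: "\<And>n. n \<ge> l \<Longrightarrow> dist (x n) (of_rat (r n)) < e / 3"
      using metric_LIMSEQ_D[OF null, of "e / 3"] e by auto
    have "rat_padic_abs CARD('a) (r m - r n) < e" if mn: "m \<ge> max k l" "n \<ge> max k l" for m n
    proof -
      have "rat_padic_abs CARD('a) (r m - r n) = dist (of_rat (r m)) (of_rat (r n) :: 'a padic)"
        by (simp add: dist_padic_def flip: of_rat_diff padic_abs_of_rat)
      also have "\<dots> \<le> dist (x m) (of_rat (r m)) + dist (x m) (x n) + dist (x n) (of_rat (r n))"
        by metric
      also have "\<dots> < e" using k[of m n] l[of m] l[of n] mn by simp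
      finally show ?thesis .
    qed
    then show "\<exists>k. \<forall>m\<ge>k. \<forall>n\<ge>k. rat_padic_abs CARD('a) (r m - r n) < e" by blast
  qed
  then have "(\<lambda>n. dist (of_rat (r n)) (padic_lim r :: 'a padic)) \<longlonglongrightarrow> 0"
    by (intro tendsto_dist_iff[THEN iffD1] padic_lim_LIMSEQ)
  then have lim: "(\<lambda>n. dist (x n) (of_rat (r n)) + dist (of_rat (r n)) (padic_lim r :: 'a padic)) \<longlonglongrightarrow> 0"
    by (rule tendsto_add_zero[OF null])
  have "(\<lambda>n. dist (x n) (padic_lim r)) \<longlonglongrightarrow> 0"
    by (rule tendsto_sandwich[OF _ _ tendsto_const lim]) (simp_all add: dist_triangle)
  then have "x \<longlonglongrightarrow> padic_lim r" by (rule tendsto_dist_iff[THEN iffD2])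
  then show "convergent x" by (auto simp: convergent_def)
qed

subsection \<open>Bivariate integer polynomials\<close>

text \<open>
  \<open>F(X,Y) \<in> \<int>[X,Y]\<close> is represented in \<open>\<int>[X][Y]\<close>: the coefficient of \<open>X\<^sup>i Y\<^sup>j\<close> is
  \<open>coeff (coeff F j) i\<close>.
\<close>

definition eval2 :: "int poly poly \<Rightarrow> 'a::comm_ring_1 \<Rightarrow> 'a \<Rightarrow> 'a" where
  "eval2 F x y = poly (map_poly (\<lambda>q. poly (map_poly of_int q) x) F) y"

text \<open>Only meaningful for \<open>F \<noteq> 0\<close>.\<close>
definition total_degree :: "int poly poly \<Rightarrow> nat" where
  "total_degree F = Max {i + j | i j. coeff (coeff F j) i \<noteq> 0}"

lemma eval2_altdef:
  "eval2 F x y = (\<Sum>j\<le>degree F. \<Sum>i\<le>degree (coeff F j). of_int (coeff (coeff F j) i) * x ^ i * y ^ j)"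
proof -
  have sum: "poly (map_poly f q) z = (\<Sum>i\<le>degree q. f (coeff q i) * z ^ i)"
    if "f 0 = 0" for f :: "'b::zero \<Rightarrow> 'a" and q z
  proof -
    have "poly (map_poly f q) z = (\<Sum>i\<le>degree (map_poly f q). f (coeff q i) * z ^ i)"
      using that by (simp add: poly_altdef coeff_map_poly)
    also have "\<dots> = (\<Sum>i\<le>degree q. f (coeff q i) * z ^ i)"
    proof (rule sum.mono_neutral_left)
      show "{..degree (map_poly f q)} \<subseteq> {..degree q}"
        using degree_map_poly_le[of f q] by auto
      show "\<forall>i\<in>{..degree q} - {..degree (map_poly f q)}. f (coeff q i) * z ^ i = 0"
        using that coeff_eq_0[of "map_poly f q"] by (auto simp: coeff_map_poly)
    qed simp
    finally show ?thesis .
  qed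
  show ?thesis
    unfolding eval2_def by (simp add: sum sum_distrib_right)
qed

end

theory Submission
  imports Defs
begin

text \<open>
  Clearing denominators, \<open>v\<^sub>n\<^sup>D F(t\<^sub>n/v\<^sub>n, u\<^sub>n/v\<^sub>n)\<close> is an integer of real size \<open>O(M\<^sub>n\<^sup>D)\<close>. Since
  \<open>F\<close> is \<open>p\<close>-adically Lipschitz on bounded sets and vanishes at \<open>(\<alpha>, \<beta>)\<close>, its \<open>p\<close>-adic size is
  \<open>O(U\<^sub>n)\<close>. A nonzero integer \<open>k\<close> satisfies \<open>|k|\<^sub>\<infinity> |k|\<^sub>p \<ge> 1\<close>, so the integer vanishes as soon as
  \<open>U\<^sub>n M\<^sub>n\<^sup>D\<close> is small enough.
\<close>

lemma rat_padic_abs_of_int: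
  assumes "prime p" "k \<noteq> 0"
  shows "rat_padic_abs p (of_int k) = inverse (real p ^ multiplicity (int p) k)"
  using rat_padic_abs_divide[OF assms(1) assms(2), of 1] by (simp add: power_int_minus)

lemma padic_abs_of_int:
  "padic_abs (of_int k :: 'p::prime_card padic) = rat_padic_abs CARD('p) (of_int k)"
  using padic_abs_of_rat[of "of_int k", where 'p = 'p] by simp

lemma padic_abs_of_int_le_1: "padic_abs (of_int k :: 'p::prime_card padic) \<le> 1"
proof (cases "k = 0")
  case False
  have "(1::real) \<le> real CARD('p) ^ multiplicity (int CARD('p)) k"
    using prime_gt_0_nat[OF prime_card[where 'a = 'p]] by (intro one_le_power) linarith
  then show ?thesis
    using False prime_card[where 'a = 'p]
    by (simp add: padic_abs_of_int rat_padic_abs_of_int inverse_le_1_iff)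
qed simp

text \<open>The exact power of \<open>p\<close> in \<open>k\<close> equals
  \<open>1 / padic_abs k\<close> and divides \<open>k\<close>, so it is at most
  \<open>\<bar>k\<bar>\<close>.\<close>

lemma one_le_abs_mult_padic_abs:
  assumes "k \<noteq> 0"
  shows "1 \<le> \<bar>real_of_int k\<bar> * padic_abs (of_int k :: 'p::prime_card padic)"
proof -
  let ?q = "CARD('p) ^ multiplicity (int CARD('p)) k"
  have "int ?q dvd k" by (simp add: multiplicity_dvd)
  then have "int ?q \<le> \<bar>k\<bar>" using assms by (intro zdvd_imp_le) auto
  then have "real ?q \<le> \<bar>real_of_int k\<bar>" by linarith
  moreover have "0 < real ?q" using prime_gt_0_nat[OF prime_card[where 'a = 'p]] by simp
  ultimately show ?thesis
    using assms prime_card[where 'a = 'p]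
    by (simp add: padic_abs_of_int rat_padic_abs_of_int field_simps)
qed

lemma padic_abs_1 [simp]: "padic_abs (1 :: 'p::prime_card padic) = 1"
  using padic_abs_of_rat[of 1, where 'p = 'p] prime_card[where 'a = 'p] by simp

lemma padic_abs_power: "padic_abs (x ^ n :: 'p::prime_card padic) = padic_abs x ^ n"
  by (induction n) (simp_all add: padic_abs_mult)

lemma padic_abs_sum_le:
  "padic_abs (\<Sum>i\<in>A. f i :: 'p::prime_card padic) \<le> (\<Sum>i\<in>A. padic_abs (f i))"
proof (induction A rule: infinite_finite_induct)
  case (insert i A)
  then show ?case using padic_abs_triangle[of "f i" "\<Sum>i\<in>A. f i"] by simp
qed simp_all

text \<open>Induction by peeling off one factor. The ultrametric inequality takes a maximum of the
  two parts, so no factor \<open>i\<close> appears. Since \<open>1 \<le> B\<close>, the exponent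
  \<open>i\<close> can stand in place of the sharper \<open>i - 1\<close>, which would be awkward at
  \<open>i = 0\<close>.\<close>

lemma padic_abs_power_diff_le:
  fixes x a :: "'p::prime_card padic"
  assumes "1 \<le> B" "padic_abs x \<le> B" "padic_abs a \<le> B"
  shows "padic_abs (x ^ i - a ^ i) \<le> B ^ i * padic_abs (x - a)"
proof (induction i)
  case (Suc i)
  have "padic_abs (x * (x ^ i - a ^ i)) \<le> B * (B ^ i * padic_abs (x - a))"
    unfolding padic_abs_mult using Suc assms by (intro mult_mono) auto
  moreover have "padic_abs (a ^ i * (x - a)) \<le> B ^ Suc i * padic_abs (x - a)"
  proof -
    have "padic_abs a ^ i \<le> B ^ i" using assms by (intro power_mono) auto
    also have "\<dots> \<le> B ^ Suc i" using assms(1) by (intro power_increasing) auto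
    finally show ?thesis unfolding padic_abs_mult padic_abs_power by (rule mult_right_mono) simp
  qed
  moreover have "x ^ Suc i - a ^ Suc i = x * (x ^ i - a ^ i) + a ^ i * (x - a)"
    by (simp add: algebra_simps)
  ultimately show ?case
    using padic_abs_ultrametric[of "x * (x ^ i - a ^ i)" "a ^ i * (x - a)"] by simp
qed simp

text \<open>Change one variable at a time, passing through \<open>x ^ i * b ^ j\<close>; the
  ultrametric inequality then avoids a factor 2.\<close>

lemma padic_abs_monomial_diff_le:
  fixes x y a b :: "'p::prime_card padic"
  assumes B: "1 \<le> B" "padic_abs x \<le> B" "padic_abs a \<le> B" "padic_abs y \<le> B" "padic_abs b \<le> B"
    and d: "padic_abs (x - a) \<le> d" "padic_abs (y - b) \<le> d"
  shows "padic_abs (x ^ i * y ^ j - a ^ i * b ^ j) \<le> B ^ (i + j) * d"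
proof -
  have "padic_abs (x ^ i * (y ^ j - b ^ j)) \<le> B ^ i * (B ^ j * padic_abs (y - b))"
    unfolding padic_abs_mult padic_abs_power using B
    by (intro mult_mono power_mono padic_abs_power_diff_le) auto
  also have "\<dots> \<le> B ^ i * (B ^ j * d)" using B d by (intro mult_left_mono) auto
  finally have 1: "padic_abs (x ^ i * (y ^ j - b ^ j)) \<le> B ^ (i + j) * d"
    by (simp add: power_add mult.assoc)
  have "padic_abs (b ^ j * (x ^ i - a ^ i)) \<le> B ^ j * (B ^ i * padic_abs (x - a))"
    unfolding padic_abs_mult padic_abs_power using B
    by (intro mult_mono power_mono padic_abs_power_diff_le) auto
  also have "\<dots> \<le> B ^ j * (B ^ i * d)" using B d by (intro mult_left_mono) auto
  finally have 2: "padic_abs (b ^ j * (x ^ i - a ^ i)) \<le> B ^ (i + j) * d"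
    by (simp add: power_add mult_ac)
  have "x ^ i * y ^ j - a ^ i * b ^ j = x ^ i * (y ^ j - b ^ j) + b ^ j * (x ^ i - a ^ i)"
    by (simp add: algebra_simps)
  then show ?thesis
    using 1 2 padic_abs_ultrametric[of "x ^ i * (y ^ j - b ^ j)" "b ^ j * (x ^ i - a ^ i)"] by simp
qed

text \<open>Lipschitz bound, summed over monomials. Integer coefficients have \<open>p\<close>-adic
  size at most 1, so the constant depends only on \<open>B\<close> and the degrees in
  \<open>F\<close>.\<close>

lemma padic_abs_eval2_diff_le:
  fixes x y a b :: "'p::prime_card padic"
  assumes B: "1 \<le> B" "padic_abs x \<le> B" "padic_abs a \<le> B" "padic_abs y \<le> B" "padic_abs b \<le> B"
    and d: "padic_abs (x - a) \<le> d" "padic_abs (y - b) \<le> d"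
  shows "padic_abs (eval2 F x y - eval2 F a b) \<le>
    (\<Sum>j\<le>degree F. \<Sum>i\<le>degree (coeff F j). B ^ (i + j)) * d"
proof -
  have term_le: "padic_abs (of_int c * (x ^ i * y ^ j - a ^ i * b ^ j)) \<le> B ^ (i + j) * d" for c i j
  proof -
    have "padic_abs (of_int c * (x ^ i * y ^ j - a ^ i * b ^ j)) \<le> 1 * (B ^ (i + j) * d)"
      unfolding padic_abs_mult using assms
      by (intro mult_mono padic_abs_of_int_le_1 padic_abs_monomial_diff_le) auto
    then show ?thesis by simp
  qed
  have "eval2 F x y - eval2 F a b = (\<Sum>j\<le>degree F. \<Sum>i\<le>degree (coeff F j).
      of_int (coeff (coeff F j) i) * (x ^ i * y ^ j - a ^ i * b ^ j))"
    by (simp add: eval2_altdef sum_subtractf right_diff_distrib mult.assoc)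
  also have "padic_abs \<dots> \<le> (\<Sum>j\<le>degree F. \<Sum>i\<le>degree (coeff F j). B ^ (i + j) * d)"
    by (intro order_trans[OF padic_abs_sum_le] sum_mono term_le)
  finally show ?thesis by (simp add: sum_distrib_right)
qed

text \<open>The point is finiteness of the set under \<open>Max\<close>: exponents of nonzero
  coefficients are bounded by the degrees in each variable.\<close>

lemma le_total_degree:
  assumes "coeff (coeff F j) i \<noteq> 0"
  shows "i + j \<le> total_degree F"
proof -
  have "{i + j | i j. coeff (coeff F j) i \<noteq> 0} \<subseteq>
      (\<Union>j\<le>degree F. (\<lambda>i. i + j) ` {..degree (coeff F j)})"
  proof safe
    fix i j assume nz: "coeff (coeff F j) i \<noteq> 0"
    then have "j \<le> degree F" by (metis coeff_0 le_degree)
    moreover have "i \<le> degree (coeff F j)" using nz by (rule le_degree)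
    ultimately show "i + j \<in> (\<Union>j\<le>degree F. (\<lambda>i. i + j) ` {..degree (coeff F j)})" by blast
  qed
  then have "finite {i + j | i j. coeff (coeff F j) i \<noteq> 0}"
    by (rule finite_subset) auto
  then show ?thesis unfolding total_degree_def using assms by (intro Max_ge) auto
qed

text \<open>The homogenization of \<open>F\<close> in degree \<open>total_degree F\<close>, kept in
  the integers. Where the natural subtraction would truncate, the coefficient is zero.\<close>

definition homogenized_eval2 :: "int poly poly \<Rightarrow> int \<Rightarrow> int \<Rightarrow> int \<Rightarrow> int" where
  "homogenized_eval2 F t u v = (\<Sum>j\<le>degree F. \<Sum>i\<le>degree (coeff F j).
     coeff (coeff F j) i * (t ^ i * u ^ j * v ^ (total_degree F - (i + j))))"

text \<open>Stated over any field of characteristic 0 to serve twice: in the \<open>p\<close>-adic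
  numbers for the size estimate, in the rationals for the conclusion.\<close>

lemma of_int_homogenized_eval2:
  assumes "v \<noteq> 0"
  shows "(of_int (homogenized_eval2 F t u v) :: 'a::field_char_0) =
    of_int v ^ total_degree F * eval2 F (of_int t / of_int v) (of_int u / of_int v)"
proof -
  let ?v = "of_int v :: 'a"
  have "of_int c * (of_int t ^ i * of_int u ^ j * ?v ^ (total_degree F - (i + j))) =
      ?v ^ total_degree F * (of_int c * (of_int t / ?v) ^ i * (of_int u / ?v) ^ j)"
    if "c = coeff (coeff F j) i" for c i j
  proof (cases "c = 0")
    case False
    then have "?v ^ total_degree F = ?v ^ (total_degree F - (i + j)) * (?v ^ i * ?v ^ j)"
      using le_total_degree[of F j i] that by (simp flip: power_add)
    then show ?thesis using assms by (simp add: power_divide)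
  qed simp
  then show ?thesis
    unfolding homogenized_eval2_def eval2_altdef sum_distrib_left
      of_int_sum of_int_mult of_int_power
    by (intro sum.cong refl) blast
qed

text \<open>Every monomial with nonzero coefficient has degree exactly \<open>total_degree F\<close>
  in \<open>t\<close>, \<open>u\<close>, \<open>v\<close> together, hence size at most
  \<open>m ^ total_degree F\<close>.\<close>

lemma abs_homogenized_eval2_le:
  assumes "\<bar>real_of_int t\<bar> \<le> m" "\<bar>real_of_int u\<bar> \<le> m" "\<bar>real_of_int v\<bar> \<le> m"
  shows "\<bar>real_of_int (homogenized_eval2 F t u v)\<bar> \<le>
    (\<Sum>j\<le>degree F. \<Sum>i\<le>degree (coeff F j). \<bar>real_of_int (coeff (coeff F j) i)\<bar>) * m ^ total_degree F"
proof -
  have m: "0 \<le> m" using assms(1) by linarith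
  have "\<bar>real_of_int (c * (t ^ i * u ^ j * v ^ (total_degree F - (i + j))))\<bar> \<le>
      \<bar>real_of_int c\<bar> * m ^ total_degree F"
    if "c = coeff (coeff F j) i" for c i j
  proof (cases "c = 0")
    case False
    then have "m ^ total_degree F = m ^ i * m ^ j * m ^ (total_degree F - (i + j))"
      using le_total_degree[of F j i] that by (simp flip: power_add)
    moreover have "\<bar>real_of_int t\<bar> ^ i * \<bar>real_of_int u\<bar> ^ j * \<bar>real_of_int v\<bar> ^ (total_degree F - (i + j))
        \<le> m ^ i * m ^ j * m ^ (total_degree F - (i + j))"
      using assms m by (intro mult_mono power_mono) auto
    ultimately show ?thesis by (simp add: abs_mult power_abs mult_left_mono)
  qed simp
  then show ?thesis
    unfolding homogenized_eval2_def of_int_sum sum_distrib_right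
    by (intro order_trans[OF sum_abs] sum_mono) blast
qed

lemma padic_LIMSEQ_abs_bounded:
  assumes "X \<longlonglongrightarrow> (a :: 'p::prime_card padic)"
  obtains B where "\<And>n. padic_abs (X n) \<le> B"
proof -
  have "bounded (range X)" using assms convergentI convergent_imp_bounded by blast
  then obtain B where "\<And>n. dist 0 (X n) \<le> B" by (auto simp: bounded_any_center[of _ 0])
  then have "padic_abs (X n) \<le> B" for n by (simp add: dist_padic_def)
  then show ?thesis by (rule that)
qed

theorem theorem17:
  fixes \<alpha> \<beta> :: "'p::prime_card padic"
    and F :: "int poly poly"
    and t u v :: "nat \<Rightarrow> int"
    and D :: nat
    and M U :: "nat \<Rightarrow> real"
  assumes "odd CARD('p)"
    and "\<alpha> \<notin> \<rat>" and "\<beta> \<notin> \<rat>"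
    and "F \<noteq> 0" and "eval2 F \<alpha> \<beta> = 0"
    and "D = total_degree F"
    and "\<And>G. G \<noteq> 0 \<Longrightarrow> eval2 G \<alpha> \<beta> = 0 \<Longrightarrow> D \<le> total_degree G"
    and "\<And>n. v n \<noteq> 0"
    and "(\<lambda>n. of_int (t n) / of_int (v n)) \<longlonglongrightarrow> \<alpha>"
    and "(\<lambda>n. of_int (u n) / of_int (v n)) \<longlonglongrightarrow> \<beta>"
    and "\<And>n. M n = Max {\<bar>real_of_int (t n)\<bar>, \<bar>real_of_int (u n)\<bar>, \<bar>real_of_int (v n)\<bar>}"
    and "\<And>n. U n = max (padic_abs (\<alpha> - of_int (t n) / of_int (v n)))
                        (padic_abs (\<beta> - of_int (u n) / of_int (v n)))"
    and "(\<lambda>n. U n * M n ^ D) \<longlonglongrightarrow> 0"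
  shows "\<forall>\<^sub>F n in sequentially.
    eval2 F (of_int (t n) / of_int (v n) :: rat) (of_int (u n) / of_int (v n)) = 0"
proof -
  define x y :: "nat \<Rightarrow> 'p padic"
    where "x n = of_int (t n) / of_int (v n)" and "y n = of_int (u n) / of_int (v n)" for n
  define A where "A n = homogenized_eval2 F (t n) (u n) (v n)" for n
  obtain B1 where B1: "\<And>n. padic_abs (x n) \<le> B1"
    using padic_LIMSEQ_abs_bounded[OF assms(9)] unfolding x_def by blast
  obtain B2 where B2: "\<And>n. padic_abs (y n) \<le> B2"
    using padic_LIMSEQ_abs_bounded[OF assms(10)] unfolding y_def by blast
  \<comment> \<open>One bound for both limits and all terms of the sequences makes the Lipschitz
    constant \<open>C1\<close> independent of \<open>n\<close>; the entry 1 supplies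
    \<open>1 \<le> B\<close>.\<close>
  define B where "B = Max {1, B1, B2, padic_abs \<alpha>, padic_abs \<beta>}"
  have B: "1 \<le> B" "padic_abs \<alpha> \<le> B" "padic_abs \<beta> \<le> B"
      "padic_abs (x n) \<le> B" "padic_abs (y n) \<le> B" for n
    using B1[of n] B2[of n] by (auto simp: B_def le_max_iff_disj)
  define C1 where "C1 = (\<Sum>j\<le>degree F. \<Sum>i\<le>degree (coeff F j). B ^ (i + j))"
  define C2 where "C2 = (\<Sum>j\<le>degree F. \<Sum>i\<le>degree (coeff F j). \<bar>real_of_int (coeff (coeff F j) i)\<bar>)"
  have abs_A: "\<bar>real_of_int (A n)\<bar> \<le> C2 * M n ^ D" for n
    unfolding A_def C2_def assms(6) by (rule abs_homogenized_eval2_le) (simp_all add: assms(11))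
  have padic_A: "padic_abs (of_int (A n) :: 'p padic) \<le> C1 * U n" for n
  proof -
    \<comment> \<open>As \<open>F\<close> vanishes at (\<alpha>, \<beta>), this bounds
      \<open>eval2 F (x n) (y n)\<close> itself.\<close>
    have "padic_abs (eval2 F (x n) (y n) - eval2 F \<alpha> \<beta>) \<le> C1 * U n"
      unfolding C1_def using B
      by (intro padic_abs_eval2_diff_le)
        (auto simp: assms(12) x_def y_def padic_abs_minus_commute[of _ \<alpha>] padic_abs_minus_commute[of _ \<beta>])
    \<comment> \<open>Clearing denominators multiplies by a power of an integer, which cannot
      increase the \<open>p\<close>-adic size.\<close>
    moreover have "padic_abs (of_int (v n) :: 'p padic) ^ D * padic_abs (eval2 F (x n) (y n))
        \<le> 1 * padic_abs (eval2 F (x n) (y n))"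
      by (intro mult_right_mono power_le_one padic_abs_of_int_le_1) auto
    ultimately show ?thesis
      using assms(5,6,8)
      by (simp add: A_def of_int_homogenized_eval2 padic_abs_mult padic_abs_power x_def y_def)
  qed
  have "(\<lambda>n. C1 * C2 * (U n * M n ^ D)) \<longlonglongrightarrow> 0"
    using tendsto_mult_left[OF assms(13), of "C1 * C2"] by simp
  then have "\<forall>\<^sub>F n in sequentially. C1 * C2 * (U n * M n ^ D) < 1"
    by (rule order_tendstoD) simp
  then show ?thesis
  proof eventually_elim
    case (elim n)
    \<comment> \<open>The right side is below 1 by the choice of \<open>n\<close>, whereas a nonzero
      \<open>A n\<close> would make the left side at least 1.\<close>
    have "\<bar>real_of_int (A n)\<bar> * padic_abs (of_int (A n) :: 'p padic) \<le> (C2 * M n ^ D) * (C1 * U n)"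
      using order_trans[OF abs_ge_zero abs_A] by (intro mult_mono abs_A padic_A) auto
    then have "A n = 0"
      using elim one_le_abs_mult_padic_abs[of "A n", where 'p = 'p] by (auto simp: mult_ac)
    \<comment> \<open>Back in the rationals, \<open>A n\<close> is a nonzero power of
      \<open>v n\<close> times the value of \<open>F\<close>, so that value is zero.\<close>
    then show ?case
      using of_int_homogenized_eval2[of "v n" F "t n" "u n", where 'a = rat] assms(8)[of n]
      by (simp add: A_def)
  qed
qed

end
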